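(* Every $n$-vertex graph $G$ containing a cycle can be decomposed into an even graph and at most $n-2$ edges; that is, there is an even subgraph $H$ of $G$ such that $|E(G)\setminus E(H)|\leq n-2$.
   Context: Graphs are finite and simple. A graph is even if every vertex has even degree (an even graph need not be connected). A decomposition of $G$ is a partition of its edge set, each part being identified with the subgraph it forms; here one part is the edge set of an even subgraph and the other parts are single edges. *)

theory Defs
  imports Main
begin

record 'a graph =
  verts :: "'a set"
  edges :: "'a set set"

definition simple_graph :: "'a graph \<Rightarrow> bool" where
  "simple_graph G \<longleftrightarrow>
     finite (verts G) \<and> (\<forall>e\<in>edges G. e \<subseteq> verts G \<and> card e = 2)"

definition subgraph :: "'a graph \<Rightarrow> 'a graph \<Rightarrow> bool" where
  "subgraph H G \<longleftrightarrow>
     simple_graph H \<and> verts H \<subseteq> verts G \<and> edges H \<subseteq> edges G"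

definition degree :: "'a graph \<Rightarrow> 'a \<Rightarrow> nat" where
  "degree G v = card {e \<in> edges G. v \<in> e}"

definition even_graph :: "'a graph \<Rightarrow> bool" where
  "even_graph G \<longleftrightarrow> (\<forall>v\<in>verts G. even (degree G v))"

(* The list enumerates the vertices of the cycle once, in cyclic order;
   the first vertex is not repeated at the end. *)
definition cycle :: "'a graph \<Rightarrow> 'a list \<Rightarrow> bool" where
  "cycle G vs \<longleftrightarrow>
     3 \<le> length vs \<and> distinct vs \<and> set vs \<subseteq> verts G \<and>
     (\<forall>i<length vs. {vs ! i, vs ! (Suc i mod length vs)} \<in> edges G)"

definition contains_cycle :: "'a graph \<Rightarrow> bool" where
  "contains_cycle G \<longleftrightarrow> (\<exists>vs. cycle G vs)"

end

(* Let H be an even edge set of maximum size and F its complement. F contains no nonempty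
   even set D, since otherwise the union of H and D would be even and larger. A cycle is even, so H has an edge uv.
   The map sending P to the set of odd-degree vertices of P other than u is therefore
   injective on subsets of F (by handshaking, a set whose only odd-degree vertex could be u
   is even), with values in the subsets of V - {u}. It misses {v}: if P had odd-degree
   vertices exactly u and v, then P, not being the single edge uv of H, would have at least
   two edges, and H - uv + P would be even and larger than H. Hence 2^|F| < 2^(n-1). *)
theory Submission
  imports Defs
begin

text \<open>Parity is taken over the whole type, with no vertex set: a vertex on no edge has degree
  0 and is never collected. Thus \<open>odd_verts P = {}\<close> expresses evenness of a bare edge
  set.\<close>

definition odd_verts :: "'a set set \<Rightarrow> 'a set" where
  "odd_verts P = {v. odd (card {e \<in> P. v \<in> e})}"

lemma odd_verts_empty [simp]: "odd_verts {} = {}"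
  by (simp add: odd_verts_def)

lemma odd_verts_singleton [simp]: "odd_verts {e} = e"
proof -
  have "{f \<in> {e}. v \<in> f} = (if v \<in> e then {e} else {})" for v by auto
  then show ?thesis by (simp add: odd_verts_def)
qed

lemma odd_card_sym_diff:
  assumes "finite A" "finite B"
  shows "odd (card (sym_diff A B)) \<longleftrightarrow> odd (card A) \<noteq> odd (card B)"
proof -
  have "card (sym_diff A B) = card (A - B) + card (B - A)"
    using assms by (intro card_Un_disjoint) auto
  moreover have "card A = card (A \<inter> B) + card (A - B)"
    using assms(1) by (rule card_Int_Diff)
  moreover have "card B = card (A \<inter> B) + card (B - A)"
    using card_Int_Diff[OF assms(2), of A] by (simp add: Int_commute)
  ultimately show ?thesis by auto
qed

text \<open>An edge common to both sets is counted twice at each of its ends and cancels modulo 2.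
  So \<open>odd_verts\<close> acts as the boundary map over GF(2), linear on finite edge
  sets.\<close>

lemma odd_verts_sym_diff:
  assumes "finite A" "finite B"
  shows "odd_verts (sym_diff A B) = sym_diff (odd_verts A) (odd_verts B)"
proof -
  have "{e \<in> sym_diff A B. v \<in> e} = sym_diff {e \<in> A. v \<in> e} {e \<in> B. v \<in> e}" for v
    by auto
  then show ?thesis
    using assms odd_card_sym_diff[of "{e \<in> A. _ \<in> e}" "{e \<in> B. _ \<in> e}"]
    by (auto simp: odd_verts_def)
qed

lemma odd_verts_subset: "odd_verts P \<subseteq> \<Union>P"
proof
  fix v assume "v \<in> odd_verts P"
  then have "{e \<in> P. v \<in> e} \<noteq> {}"
    unfolding odd_verts_def by (metis (lifting) mem_Collect_eq card.empty even_zero)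
  then show "v \<in> \<Union>P" by blast
qed

text \<open>Handshaking: the degrees sum to twice the number of edges, so an even number of them are
  odd.\<close>

lemma even_card_odd_verts:
  assumes "finite P" "\<And>e. e \<in> P \<Longrightarrow> card e = 2"
  shows "even (card (odd_verts P))"
proof -
  let ?V = "\<Union>P"
  have fin: "finite ?V"
    using assms by (metis card.infinite finite_Union zero_neq_numeral)
  have "(\<Sum>v\<in>?V. card {e \<in> P. v \<in> e}) = 2 * card P"
  proof (rule sum_multicount[OF fin assms(1)], rule ballI)
    fix e assume "e \<in> P"
    then have "{v \<in> ?V. v \<in> e} = e" by auto
    with assms \<open>e \<in> P\<close> show "card {v \<in> ?V. v \<in> e} = 2" by simp
  qed
  then have "even (\<Sum>v\<in>?V. card {e \<in> P. v \<in> e})" by simp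
  then have "even (card {v \<in> ?V. odd (card {e \<in> P. v \<in> e})})"
    using fin by (simp add: even_sum_iff)
  moreover have "{v \<in> ?V. odd (card {e \<in> P. v \<in> e})} = odd_verts P"
    using odd_verts_subset[of P] by (auto simp: odd_verts_def)
  ultimately show ?thesis by simp
qed

text \<open>Boundaries telescope along the cycle, which avoids computing degrees: the path from the
  first to the last vertex has these two as its boundary, and the closing edge \<open>e\<close>
  cancels them.\<close>

lemma cycle_nonempty_even_set:
  assumes "simple_graph G" "cycle G vs"
  shows "\<exists>D \<subseteq> edges G. finite D \<and> D \<noteq> {} \<and> odd_verts D = {}"
proof -
  define m where "m = length vs"
  define e where "e = {vs ! (m - 1), vs ! 0}"
  have m: "3 \<le> m" and dist: "distinct vs"
    and edge: "\<And>i. i < m \<Longrightarrow> {vs ! i, vs ! (Suc i mod m)} \<in> edges G"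
    using assms(2) by (auto simp: cycle_def m_def)
  have eG: "e \<in> edges G" using edge[of "m - 1"] m by (simp add: e_def)
  \<comment> \<open>Excluding \<open>e\<close> from \<open>P\<close> ensures that \<open>e\<close>
    survives in the final symmetric difference, which is therefore nonempty. For
    \<open>k = 0\<close> the stated boundary is empty.\<close>
  have path: "k < m \<Longrightarrow> \<exists>P \<subseteq> edges G - {e}. finite P \<and>
      odd_verts P = sym_diff {vs ! 0} {vs ! k}" for k
  proof (induction k)
    case 0
    show ?case by (rule exI[of _ "{}"]) simp
  next
    case (Suc k)
    then obtain P where P: "P \<subseteq> edges G - {e}" "finite P"
      "odd_verts P = sym_diff {vs ! 0} {vs ! k}" by auto
    let ?f = "{vs ! k, vs ! Suc k}"
    have ne: "vs ! k \<noteq> vs ! Suc k"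
      using dist Suc.prems by (simp add: nth_eq_iff_index_eq m_def)
    \<comment> \<open>A path edge can equal the closing edge only if \<open>m = 2\<close>, which
      \<open>3 \<le> m\<close> rules out.\<close>
    have "?f \<noteq> e"
    proof
      assume "?f = e"
      then have "vs ! k = vs ! (m - 1) \<or> vs ! k = vs ! 0 \<and> vs ! Suc k = vs ! (m - 1)"
        unfolding e_def doubleton_eq_iff by blast
      then have "k = m - 1 \<or> k = 0 \<and> Suc k = m - 1"
        using Suc.prems m by (simp add: nth_eq_iff_index_eq[OF dist] flip: m_def)
      then show False using Suc.prems m by linarith
    qed
    moreover have "?f \<in> edges G" using edge[of k] Suc.prems by simp
    moreover have "odd_verts (sym_diff P {?f}) = sym_diff {vs ! 0} {vs ! Suc k}"
      unfolding odd_verts_sym_diff[OF P(2) finite.insertI[OF finite.emptyI]] P(3)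
        odd_verts_singleton
      using ne by auto
    ultimately show ?case
      using P by (intro exI[of _ "sym_diff P {?f}"]) auto
  qed
  obtain P where P: "P \<subseteq> edges G - {e}" "finite P"
    "odd_verts P = sym_diff {vs ! 0} {vs ! (m - 1)}"
    using path[of "m - 1"] m by auto
  have "vs ! 0 \<noteq> vs ! (m - 1)"
    using m by (subst nth_eq_iff_index_eq[OF dist]) (simp_all flip: m_def)
  then have "odd_verts (sym_diff P {e}) = {}"
    unfolding odd_verts_sym_diff[OF P(2) finite.insertI[OF finite.emptyI]] P(3)
      odd_verts_singleton
    by (auto simp: e_def)
  then show ?thesis
    using P eG by (intro exI[of _ "sym_diff P {e}"]) auto
qed

text \<open>Injectivity of \<open>\<phi>\<close> alone would give the bound
  \<open>card V - 1\<close>; the missed value \<open>{v}\<close>, available because \<open>H\<close>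
  has an edge, gains the last unit. That edge also gives \<open>V\<close> two vertices, so the
  truncated subtraction is exact.\<close>

lemma card_complement_max_even_set:
  fixes V :: "'a set" and E :: "'a set set"
  assumes fin: "finite V" and E: "\<And>e. e \<in> E \<Longrightarrow> e \<subseteq> V \<and> card e = 2"
    and H: "H \<subseteq> E" "odd_verts H = {}" "H \<noteq> {}"
    and max: "\<And>K. K \<subseteq> E \<Longrightarrow> odd_verts K = {} \<Longrightarrow> card K \<le> card H"
  shows "card (E - H) \<le> card V - 2"
proof -
  have "E \<subseteq> Pow V" using E by auto
  then have finE: "finite E" using fin by (meson finite_Pow_iff finite_subset)
  have fin_sub: "finite K" if "K \<subseteq> E" for K using that finE finite_subset by blast
  have even: "even (card (odd_verts K))" if "K \<subseteq> E" for K
    using even_card_odd_verts[of K] fin_sub[OF that] E that by blast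
  have in_V: "odd_verts K \<subseteq> V" if "K \<subseteq> E" for K
    using odd_verts_subset[of K] E that by blast
  obtain e where "e \<in> H" using H by auto
  then have "e \<in> E" using H by auto
  obtain u v where uv: "e = {u, v}" "u \<noteq> v"
    using E[OF \<open>e \<in> E\<close>] by (meson card_2_iff)
  have "u \<in> V" "v \<in> V" using E[OF \<open>e \<in> E\<close>] uv by auto
  \<comment> \<open>Deleting \<open>u\<close> loses no information, since the even size of
    \<open>odd_verts P\<close> determines whether \<open>u\<close> belongs to it, but it halves the
    range.\<close>
  define \<phi> where "\<phi> P = odd_verts P - {u}" for P :: "'a set set"

  have no_even: "D = {}" if "D \<subseteq> E - H" "odd_verts D = {}" for D
  proof -
    have D: "finite D" "finite H" using that H fin_sub by blast+
    \<comment> \<open>Disjointness turns the union into a symmetric difference, so that linearity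
      applies.\<close>
    have sd: "sym_diff H D = H \<union> D" using that by auto
    have "odd_verts (H \<union> D) = {}"
      using odd_verts_sym_diff[OF D(2,1)] that H unfolding sd by simp
    then have "card (H \<union> D) \<le> card H" using that H by (intro max) auto
    moreover have "card (H \<union> D) = card H + card D"
      using D that by (intro card_Un_disjoint) auto
    ultimately show "D = {}" using D by simp
  qed

  have "inj_on \<phi> (Pow (E - H))"
  proof (rule inj_onI)
    fix P Q assume PQ: "P \<in> Pow (E - H)" "Q \<in> Pow (E - H)" "\<phi> P = \<phi> Q"
    let ?D = "sym_diff P Q"
    have D: "?D \<subseteq> E - H" using PQ by auto
    have "odd_verts ?D = sym_diff (odd_verts P) (odd_verts Q)"
      using PQ by (intro odd_verts_sym_diff fin_sub) auto
    then have "odd_verts ?D \<subseteq> {u}" using PQ(3) unfolding \<phi>_def by blast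
    moreover have "even (card (odd_verts ?D))" using even D by blast
    ultimately have "odd_verts ?D = {}" using subset_singletonD by fastforce
    then have "?D = {}" using no_even D by blast
    then show "P = Q" by blast
  qed
  then have "card (\<phi> ` Pow (E - H)) = 2 ^ card (E - H)"
    using finE by (simp add: card_image card_Pow)

  moreover have "{v} \<notin> \<phi> ` Pow (E - H)"
  proof
    assume "{v} \<in> \<phi> ` Pow (E - H)"
    then obtain P where P: "P \<subseteq> E - H" "\<phi> P = {v}" by auto
    have finP: "finite P" "finite H" using P H fin_sub by blast+
    have "odd_verts P = {v} \<or> odd_verts P = {u, v}"
      using P(2) unfolding \<phi>_def by blast
    moreover have "even (card (odd_verts P))" using even[of P] P(1) by blast
    then have "odd_verts P \<noteq> {v}" by (metis odd_one is_singletonI is_singleton_altdef)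
    ultimately have oP: "odd_verts P = e" using uv(1) by simp
    have "P \<noteq> {}" using oP uv(1) by (metis insert_not_empty odd_verts_empty)
    then have "card P \<noteq> 0" using finP by simp
    moreover have "card P \<noteq> 1"
    proof
      assume "card P = 1"
      then obtain f where "P = {f}" by (rule card_1_singletonE)
      then have "e \<in> P" using oP by simp
      then show False using P(1) \<open>e \<in> H\<close> by blast
    qed
    ultimately have "2 \<le> card P" by linarith
    \<comment> \<open>Exchange \<open>e\<close> for \<open>P\<close>: both have boundary
      \<open>e\<close>, so evenness is preserved, while the size grows by \<open>card P - 1\<close>,
      which is positive.\<close>
    let ?K = "(H - {e}) \<union> P"
    have "?K = sym_diff H (sym_diff {e} P)" using P \<open>e \<in> H\<close> by auto
    moreover have "odd_verts (sym_diff {e} P) = {}"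
      using odd_verts_sym_diff[of "{e}" P] finP oP by simp
    ultimately have "odd_verts ?K = {}"
      using odd_verts_sym_diff[of H "sym_diff {e} P"] finP H by simp
    then have "card ?K \<le> card H" using P H by (intro max) auto
    moreover have "card ?K = card (H - {e}) + card P"
      using finP P by (intro card_Un_disjoint) auto
    moreover have "Suc (card (H - {e})) = card H"
      using card_Suc_Diff1 finP \<open>e \<in> H\<close> by metis
    ultimately show False using \<open>2 \<le> card P\<close> by simp
  qed
  moreover have "\<phi> ` Pow (E - H) \<subseteq> Pow (V - {u})"
    using in_V unfolding \<phi>_def by blast
  moreover have "{v} \<in> Pow (V - {u})" using uv \<open>v \<in> V\<close> by auto
  ultimately have "2 ^ card (E - H) < card (Pow (V - {u}))"
    using fin psubset_card_mono[of "Pow (V - {u})" "\<phi> ` Pow (E - H)"] by auto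
  also have "\<dots> = 2 ^ (card V - 1)"
    using fin \<open>u \<in> V\<close> by (simp add: card_Pow)
  finally have "card (E - H) < card V - 1" by simp
  then show ?thesis by simp
qed

theorem theorem1p4:
  fixes G :: "'a graph" and n :: nat
  assumes "simple_graph G"
    and "card (verts G) = n"
    and "contains_cycle G"
  shows "\<exists>H. subgraph H G \<and> even_graph H \<and> card (edges G - edges H) \<le> n - 2"
proof -
  let ?E = "edges G" and ?V = "verts G"
  have fin: "finite ?V" and E: "\<And>e. e \<in> ?E \<Longrightarrow> e \<subseteq> ?V \<and> card e = 2"
    using assms(1) by (auto simp: simple_graph_def)
  have "?E \<subseteq> Pow ?V" using E by auto
  then have finE: "finite ?E" using fin by (meson finite_Pow_iff finite_subset)
  let ?S = "{K. K \<subseteq> ?E \<and> odd_verts K = {}}"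
  have finS: "finite ?S" using finE by simp
  \<comment> \<open>The maximum exists because the family is finite and the empty edge set is
    even.\<close>
  have "{} \<in> ?S" by simp
  then have "Max (card ` ?S) \<in> card ` ?S" using finS by (intro Max_in) auto
  then obtain H where H: "H \<in> ?S" "Max (card ` ?S) = card H" by (rule imageE)
  have max: "card K \<le> card H" if "K \<in> ?S" for K
    using that finS unfolding H(2)[symmetric] by (intro Max_ge) auto
  obtain vs where "cycle G vs" using assms(3) unfolding contains_cycle_def ..
  then obtain D where "D \<in> ?S" "D \<noteq> {}" "finite D"
    using cycle_nonempty_even_set[OF assms(1), of vs] by blast
  then have "H \<noteq> {}" using max[of D] by auto
  then have "card (?E - H) \<le> card ?V - 2"
    using H(1) max by (intro card_complement_max_even_set[OF fin E]) auto
  \<comment> \<open>The witness keeps every vertex of \<open>G\<close>; those that \<open>H\<close>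
    does not meet have degree 0, which is even.\<close>
  moreover have "subgraph \<lparr>verts = ?V, edges = H\<rparr> G"
    using H assms(1) by (auto simp: subgraph_def simple_graph_def)
  moreover have "even_graph \<lparr>verts = ?V, edges = H\<rparr>"
    using H by (auto simp: even_graph_def degree_def odd_verts_def)
  ultimately show ?thesis
    using assms(2) by (intro exI[of _ "\<lparr>verts = ?V, edges = H\<rparr>"]) simp
qed

end
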